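(* Let $\Gamma$ be a countable discrete group, let $A\in\mathcal{N}\Gamma$ be positive, and injective on $\mathbb{C}\Gamma$, and let $F$ and $F'=F\,\dot\cup\,\{\gamma\}$ be finite subsets of $\Gamma$, where $\gamma\in\Gamma\setminus F$. Let $\varphi=\mathrm{id}-\psi:\mathbb{C}F'\to\mathbb{C}F'$, where $\psi=i_FA_F^{-1}p_FA\,i_{F'}$, and set $\Phi_\gamma=\varphi(\gamma)\in\mathbb{C}F'$. Then $$\det A_{F'}=\|\Phi_\gamma\|_A^2\,\det A_F .$$
   Context: For a discrete group $\Gamma$, $L^2(\Gamma)$ is the Hilbert space of formal series $\sum_\gamma x_\gamma\gamma$ with $\sum_\gamma|x_\gamma|^2<\infty$, with scalar product $(\cdot,\cdot)$ for which the elements of $\Gamma$ form an orthonormal basis; $\mathbb{C}\Gamma\subset L^2(\Gamma)$ is the subspace of finite sums. The von Neumann algebra $\mathcal{N}\Gamma$ is the algebra of bounded operators $A: L^2(\Gamma)\to L^2(\Gamma)$ that commute with left multiplication by every $\gamma\in\Gamma$. "Positive" means positive semidefinite. For a finite subset $F\subset\Gamma$ let $\mathbb{C}F\subset L^2(\Gamma)$ be the span of $F$, $i_F:\mathbb{C}F\hookrightarrow L^2(\Gamma)$ the inclusion and $p_F:L^2(\Gamma)\to\mathbb{C}F$ the orthogonal projection; for $A\in\mathcal{N}\Gamma$ put $A_F=p_F A\, i_F\in\operatorname{End}(\mathbb{C}F)$. If $A$ is positive, and injective on $\mathbb{C}\Gamma$, then $A_F$ is a positive automorphism of $\mathbb{C}F$,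 and $(u,v)_A:=(Au,v)$ is a positive definite scalar product on $\mathbb{C}\Gamma$, with norm $\|u\|_A=(u,u)_A^{1/2}$. The map $\psi$ is the $(\cdot,\cdot)_A$-orthogonal projection of $\mathbb{C}F'$ onto $\mathbb{C}F$, so $\varphi$ is the $(\cdot,\cdot)_A$-orthogonal projection of $\mathbb{C}F'$ onto the $(\cdot,\cdot)_A$-orthogonal complement of $\mathbb{C}F$ in $\mathbb{C}F'$. *)

theory Defs
  imports
    "HOL-Analysis.Infinite_Sum"
    "HOL-Library.Countable_Set"
    "HOL-Library.Nonpos_Ints"
    "HOL-Algebra.Group"
    "Jordan_Normal_Form.Determinant"
begin

text \<open>A formal series over the group is its coefficient function, which vanishes off the carrier.\<close>

definition L2 :: "('g, 'b) monoid_scheme \<Rightarrow> ('g \<Rightarrow> complex) set" where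
  "L2 G = {x. (\<forall>g. g \<notin> carrier G \<longrightarrow> x g = 0) \<and> (\<lambda>g. (cmod (x g))\<^sup>2) summable_on carrier G}"

definition l2_inner :: "('g, 'b) monoid_scheme \<Rightarrow> ('g \<Rightarrow> complex) \<Rightarrow> ('g \<Rightarrow> complex) \<Rightarrow> complex" where
  "l2_inner G x y = (\<Sum>\<^sub>\<infinity>g\<in>carrier G. x g * cnj (y g))"

definition l2_norm :: "('g, 'b) monoid_scheme \<Rightarrow> ('g \<Rightarrow> complex) \<Rightarrow> real" where
  "l2_norm G x = sqrt (\<Sum>\<^sub>\<infinity>g\<in>carrier G. (cmod (x g))\<^sup>2)"

definition basis_vec :: "'g \<Rightarrow> 'g \<Rightarrow> complex" where
  "basis_vec g = (\<lambda>h. if h = g then 1 else 0)"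

definition fin_span :: "'g set \<Rightarrow> ('g \<Rightarrow> complex) set" where
  "fin_span F = {x. \<exists>c. x = (\<lambda>h. \<Sum>g\<in>F. c g * basis_vec g h)}"

definition group_alg :: "('g, 'b) monoid_scheme \<Rightarrow> ('g \<Rightarrow> complex) set" where
  "group_alg G = (\<Union>F\<in>{F. finite F \<and> F \<subseteq> carrier G}. fin_span F)"

text \<open>Operators are functions of which only the values on \<open>L2 G\<close> matter.\<close>

definition bounded_op :: "('g, 'b) monoid_scheme \<Rightarrow> (('g \<Rightarrow> complex) \<Rightarrow> ('g \<Rightarrow> complex)) \<Rightarrow> bool" where
  "bounded_op G A \<longleftrightarrow>
     (\<forall>x\<in>L2 G. A x \<in> L2 G) \<and>
     (\<forall>x\<in>L2 G. \<forall>y\<in>L2 G. A (\<lambda>g. x g + y g) = (\<lambda>g. A x g + A y g)) \<and>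
     (\<forall>c. \<forall>x\<in>L2 G. A (\<lambda>g. c * x g) = (\<lambda>g. c * A x g)) \<and>
     (\<exists>C. \<forall>x\<in>L2 G. l2_norm G (A x) \<le> C * l2_norm G x)"

text \<open>Multiplying \<open>\<Sum>\<^sub>g x\<^sub>g g\<close> by \<open>\<gamma>\<close> on the left
  gives the series whose coefficient at \<open>h\<close> is that of \<open>x\<close> at \<open>\<gamma>\<^sup>-\<^sup>1 h\<close>.\<close>

definition left_mult :: "('g, 'b) monoid_scheme \<Rightarrow> 'g \<Rightarrow> ('g \<Rightarrow> complex) \<Rightarrow> ('g \<Rightarrow> complex)" where
  "left_mult G \<gamma> x = (\<lambda>h. if h \<in> carrier G then x (inv\<^bsub>G\<^esub> \<gamma> \<otimes>\<^bsub>G\<^esub> h) else 0)"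

definition group_vN :: "('g, 'b) monoid_scheme \<Rightarrow> (('g \<Rightarrow> complex) \<Rightarrow> ('g \<Rightarrow> complex)) set" where
  "group_vN G = {A. bounded_op G A \<and>
     (\<forall>\<gamma>\<in>carrier G. \<forall>x\<in>L2 G. A (left_mult G \<gamma> x) = left_mult G \<gamma> (A x))}"

definition positive_op :: "('g, 'b) monoid_scheme \<Rightarrow> (('g \<Rightarrow> complex) \<Rightarrow> ('g \<Rightarrow> complex)) \<Rightarrow> bool" where
  "positive_op G A \<longleftrightarrow> (\<forall>x\<in>L2 G. l2_inner G (A x) x \<in> \<real>\<^sub>\<ge>\<^sub>0)"

text \<open>For positive \<open>A\<close> the product \<open>(A u, u)\<close> is a nonnegative real, so taking \<open>Re\<close> loses nothing.\<close>

definition op_norm :: "('g, 'b) monoid_scheme \<Rightarrow> (('g \<Rightarrow> complex) \<Rightarrow> ('g \<Rightarrow> complex)) \<Rightarrow> ('g \<Rightarrow> complex) \<Rightarrow> real" where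
  "op_norm G A u = sqrt (Re (l2_inner G (A u) u))"

definition orth_proj :: "('g, 'b) monoid_scheme \<Rightarrow> ('g \<Rightarrow> complex) set \<Rightarrow> ('g \<Rightarrow> complex) \<Rightarrow> ('g \<Rightarrow> complex)" where
  "orth_proj G V x = (THE v. v \<in> V \<and> (\<forall>w\<in>V. l2_inner G (\<lambda>g. x g - v g) w = 0))"

text \<open>\<open>fin_span F\<close> is literally a subset of \<open>L2 G\<close>,
  so the inclusion is the identity and is not written.\<close>

definition compression :: "('g, 'b) monoid_scheme \<Rightarrow> (('g \<Rightarrow> complex) \<Rightarrow> ('g \<Rightarrow> complex)) \<Rightarrow> 'g set \<Rightarrow>
    ('g \<Rightarrow> complex) \<Rightarrow> ('g \<Rightarrow> complex)" where
  "compression G A F u = orth_proj G (fin_span F) (A u)"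

definition endo_mat :: "(nat \<Rightarrow> 'g) \<Rightarrow> nat \<Rightarrow> (('g \<Rightarrow> complex) \<Rightarrow> ('g \<Rightarrow> complex)) \<Rightarrow> complex mat" where
  "endo_mat e n T = mat n n (\<lambda>(i, j). T (basis_vec (e j)) (e i))"

text \<open>The determinant of an endomorphism of \<open>fin_span F\<close>,
  computed in the basis \<open>F\<close>; by \<open>endo_det_eq\<close> below the enumeration of \<open>F\<close> is irrelevant.\<close>

definition endo_det :: "'g set \<Rightarrow> (('g \<Rightarrow> complex) \<Rightarrow> ('g \<Rightarrow> complex)) \<Rightarrow> complex" where
  "endo_det F T = det (endo_mat (SOME e. bij_betw e {..<card F} F) (card F) T)"

lemma fin_span_iff:
  assumes "finite F"
  shows "x \<in> fin_span F \<longleftrightarrow> (\<forall>g. g \<notin> F \<longrightarrow> x g = 0)"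
proof -
  have *: "(\<Sum>g\<in>F. c g * basis_vec g h) = (if h \<in> F then c h else 0)" for c :: "'a \<Rightarrow> complex" and h
    using assms by (simp add: basis_vec_def if_distrib[of "\<lambda>t. _ * t"] cong: if_cong)
  show ?thesis
    unfolding fin_span_def * by (auto simp: fun_eq_iff)
qed

lemma fin_span_subset_L2:
  assumes "finite F" "F \<subseteq> carrier G"
  shows "fin_span F \<subseteq> L2 G"
proof
  fix x assume x: "x \<in> fin_span F"
  have "(\<lambda>g. (cmod (x g))\<^sup>2) summable_on F"
    using assms by simp
  then have "(\<lambda>g. (cmod (x g))\<^sup>2) summable_on carrier G"
    by (rule summable_on_cong_neutral[THEN iffD1, rotated -1]) (use x assms in \<open>auto simp: fin_span_iff\<close>)
  then show "x \<in> L2 G"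
    using x assms by (auto simp: L2_def fin_span_iff)
qed

lemma l2_inner_fin_span:
  assumes "finite F" "F \<subseteq> carrier G" "w \<in> fin_span F"
  shows "l2_inner G x w = (\<Sum>g\<in>F. x g * cnj (w g))"
proof -
  have "l2_inner G x w = (\<Sum>\<^sub>\<infinity>g\<in>F. x g * cnj (w g))"
    unfolding l2_inner_def
    by (rule infsum_cong_neutral) (use assms in \<open>auto simp: fin_span_iff\<close>)
  with assms(1) show ?thesis by simp
qed

lemma orth_proj_fin_span:
  assumes F: "finite F" "F \<subseteq> carrier G"
  shows "orth_proj G (fin_span F) x = (\<lambda>g. if g \<in> F then x g else 0)"
  unfolding orth_proj_def
proof (rule the_equality)
  show "(\<lambda>g. if g \<in> F then x g else 0) \<in> fin_span F \<and>
    (\<forall>w\<in>fin_span F. l2_inner G (\<lambda>g. x g - (if g \<in> F then x g else 0)) w = 0)"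
    using F by (auto simp: fin_span_iff l2_inner_fin_span)
next
  fix v assume v: "v \<in> fin_span F \<and> (\<forall>w\<in>fin_span F. l2_inner G (\<lambda>g. x g - v g) w = 0)"
  have "v g = x g" if "g \<in> F" for g
  proof -
    have b: "basis_vec g \<in> fin_span F"
      using that F by (auto simp: fin_span_iff basis_vec_def)
    have "(\<Sum>h\<in>F. (x h - v h) * cnj (basis_vec g h)) = 0"
      using v b l2_inner_fin_span[OF F b] by metis
    also have "(\<Sum>h\<in>F. (x h - v h) * cnj (basis_vec g h)) = (\<Sum>h\<in>F. if h = g then x h - v h else 0)"
      by (rule sum.cong) (auto simp: basis_vec_def)
    finally show ?thesis
      using that F by simp
  qed
  then show "v = (\<lambda>g. if g \<in> F then x g else 0)"
    using v F by (auto simp: fin_span_iff fun_eq_iff)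
qed

lemma det_endo_mat_indep:
  assumes e: "bij_betw e {..<n} F" and e': "bij_betw e' {..<n} F"
  shows "det (endo_mat e n T) = det (endo_mat e' n T)"
proof -
  define q where "q = (\<lambda>i. if i < n then inv_into {..<n} e' (e i) else i)"
  have bij: "bij_betw (inv_into {..<n} e' \<circ> e) {..<n} {..<n}"
    using e e' bij_betw_inv_into bij_betw_trans by blast
  have q: "q permutes {0..<n}"
  proof (rule bij_imp_permutes)
    show "bij_betw q {0..<n} {0..<n}"
      using bij by (subst bij_betw_cong[of _ _ "inv_into {..<n} e' \<circ> e"]) (auto simp: q_def lessThan_atLeast0)
  qed (auto simp: q_def)
  have qn: "q i < n" and qe: "e' (q i) = e i" if "i < n" for i
  proof -
    have "e i \<in> e' ` {..<n}"
      using that e e' by (auto simp: bij_betw_def)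
    then show "q i < n" "e' (q i) = e i"
      using that inv_into_into[of "e i" e' "{..<n}"] f_inv_into_f[of "e i" e' "{..<n}"]
      by (auto simp: q_def)
  qed
  define M where "M = endo_mat e' n T"
  define N where "N = mat n n (\<lambda>(i, j). M $$ (q i, j))"
  have M: "M \<in> carrier_mat n n" and N: "N \<in> carrier_mat n n"
    by (auto simp: M_def N_def endo_mat_def)
  have dN: "det N = signof q * det M"
    unfolding N_def by (rule det_permute_rows[OF M q])
  have "det (mat n n (\<lambda>(i, j). (transpose_mat N) $$ (q i, j))) = signof q * det (transpose_mat N)"
    by (rule det_permute_rows[OF _ q]) (use N in simp)
  also have "mat n n (\<lambda>(i, j). (transpose_mat N) $$ (q i, j)) = transpose_mat (endo_mat e n T)"
    by (rule eq_matI) (auto simp: N_def M_def endo_mat_def qn qe)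
  finally have "det (endo_mat e n T) = signof q * (signof q * det M)"
    using N dN by (simp add: det_transpose[of _ n] endo_mat_def)
  then show ?thesis
    by (simp add: M_def sign_def)
qed

lemma endo_det_eq:
  assumes "bij_betw e {..<card F} F"
  shows "endo_det F T = det (endo_mat e (card F) T)"
  unfolding endo_det_def by (rule det_endo_mat_indep[OF someI[of _ e] assms]) (rule assms)

end

theory Submission
  imports Defs
begin

text \<open>The vector \<open>\<Phi>\<^sub>\<gamma> = \<gamma> - v\<close> with \<open>v\<close> supported on \<open>F\<close> satisfies \<open>A \<Phi>\<^sub>\<gamma> = 0\<close> on \<open>F\<close>, so that
  \<open>\<parallel>\<Phi>\<^sub>\<gamma>\<parallel>\<^sub>A\<^sup>2 = (A \<Phi>\<^sub>\<gamma>)(\<gamma>)\<close>. Replacing the column of \<open>\<gamma>\<close> in the matrix of \<open>A\<^bsub>F'\<^esub>\<close> by \<open>A \<Phi>\<^sub>\<gamma>\<close> does not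
  change the determinant, and expanding along that column leaves one term. The existence of \<open>v\<close>
  rests on the injectivity of \<open>A\<^sub>F\<close>: if \<open>A\<^sub>F u = 0\<close> then \<open>(A u, u) = 0\<close>, and positivity forces
  \<open>A u = 0\<close>.\<close>

section \<open>Matrix determinants and a nonnegativity criterion\<close>

text \<open>By Cramer's rule, replacing the last column of \<open>M\<close> by
  \<open>M *\<^sub>v x\<close> multiplies the determinant by \<open>x $ n\<close>, which is 1. The
  new column has at most its last entry nonzero, so Laplace expansion along it leaves one
  term.\<close>

lemma det_eq_last_pivot:
  fixes M :: "'a :: idom mat"
  assumes M: "M \<in> carrier_mat (Suc n) (Suc n)" and x: "x \<in> carrier_vec (Suc n)"
    and one: "x $ n = 1" and zero: "\<And>i. i < n \<Longrightarrow> (M *\<^sub>v x) $ i = 0"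
  shows "det M = (M *\<^sub>v x) $ n * det (mat_delete M n n)"
proof -
  define N where "N = replace_col M (M *\<^sub>v x) n"
  have N: "N \<in> carrier_mat (Suc n) (Suc n)"
    using M by (simp add: N_def replace_col_def)
  have del: "mat_delete N n n = mat_delete M n n"
    by (rule eq_matI) (use M in \<open>auto simp: N_def replace_col_def mat_delete_def\<close>)
  have col: "N $$ (i, n) = (M *\<^sub>v x) $ i" if "i \<le> n" for i
    using M that by (simp add: N_def replace_col_def)
  have "det M = det N"
    using cramer_lemma_mat[OF M x, of n] one by (simp add: N_def)
  also have "\<dots> = (\<Sum>i<Suc n. N $$ (i, n) * cofactor N i n)"
    by (rule laplace_expansion_column[OF N]) simp
  \<comment> \<open>The cofactor carries the sign (-1)^(n + n), which becomes 1 once the exponent is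
    folded into 2 * n.\<close>
  also have "\<dots> = (M *\<^sub>v x) $ n * det (mat_delete M n n)"
    by (simp add: col zero cofactor_def del flip: mult_2)
  finally show ?thesis .
qed

text \<open>A trivial kernel makes the determinant nonzero, and the adjugate divided by it produces
  the solution.\<close>

lemma inj_square_mat_solvable:
  fixes M :: "'a :: field mat"
  assumes M: "M \<in> carrier_mat n n" and b: "b \<in> carrier_vec n"
    and inj: "\<And>v. v \<in> carrier_vec n \<Longrightarrow> M *\<^sub>v v = 0\<^sub>v n \<Longrightarrow> v = 0\<^sub>v n"
  obtains v where "v \<in> carrier_vec n" "M *\<^sub>v v = b"
proof -
  have "det M \<noteq> 0"
    using det_0_iff_vec_prod_zero_field[OF M] inj by blast
  have adj: "adj_mat M \<in> carrier_mat n n" by (rule adj_mat(1)[OF M])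
  have "M *\<^sub>v (adj_mat M *\<^sub>v b) = (M * adj_mat M) *\<^sub>v b"
    using assoc_mult_mat_vec[OF M adj b] by simp
  also have "\<dots> = det M \<cdot>\<^sub>v b"
    unfolding adj_mat(2)[OF M] using b by (intro eq_vecI) auto
  finally have "M *\<^sub>v ((1 / det M) \<cdot>\<^sub>v (adj_mat M *\<^sub>v b)) = b"
    using \<open>det M \<noteq> 0\<close> b adj by (simp add: mult_mat_vec[OF M] smult_smult_assoc)
  then show ?thesis
    using that[of "(1 / det M) \<cdot>\<^sub>v (adj_mat M *\<^sub>v b)"] adj b by simp
qed

text \<open>The expression is (A x, x) for x = u + t w when (A u, u) = 0, with a = (A w, u), b = (A
  u, w), c = (A w, w). For small t the first-order part dominates and changes sign with t, so it
  vanishes; real and purely imaginary t give a + b = 0 and a - b = 0.\<close>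

lemma zero_if_perturbation_nonneg:
  fixes a b c :: complex
  assumes nonneg: "\<And>t. t * a + cnj t * b + t * cnj t * c \<in> \<real>\<^sub>\<ge>\<^sub>0" and c: "c \<in> \<real>\<^sub>\<ge>\<^sub>0"
  shows "b = 0"
proof -
  have lin: "z = 0" if "\<And>r::real. of_real r * z + of_real (r\<^sup>2) * c \<in> \<real>\<^sub>\<ge>\<^sub>0" for z
  proof (rule complex_eqI)
    have im: "Im c = 0" and re: "Re c \<ge> 0" using c by (auto simp: complex_nonneg_Reals_iff)
    show "Im z = Im 0"
      using that[of 1] im by (simp add: complex_nonneg_Reals_iff)
    have *: "r * Re z + r\<^sup>2 * Re c \<ge> 0" for r
      using that[of r] im by (simp add: complex_nonneg_Reals_iff)
    \<comment> \<open>With this \<open>r\<close> the quadratic expression equals -r^2, forcing r =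
      0. The summand 1 keeps the denominator positive even if \<open>Re c = 0\<close>.\<close>
    define r where "r = - Re z / (Re c + 1)"
    have z: "Re z = - r * (Re c + 1)" using re by (simp add: r_def field_simps)
    have "0 \<le> r * Re z + r\<^sup>2 * Re c" by (rule *)
    also have "\<dots> = - r\<^sup>2" by (simp add: z algebra_simps power2_eq_square)
    finally show "Re z = Re 0" by (simp add: z)
  qed
  have "a + b = 0"
    by (rule lin) (use nonneg[of "of_real r" for r] in \<open>simp add: algebra_simps power2_eq_square\<close>)
  moreover have "\<i> * (a - b) = 0"
  proof (rule lin)
    fix r :: real
    show "of_real r * (\<i> * (a - b)) + of_real (r\<^sup>2) * c \<in> \<real>\<^sub>\<ge>\<^sub>0"
      using nonneg[of "\<i> * of_real r"] by (simp add: algebra_simps power2_eq_square)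
  qed
  ultimately show ?thesis by simp
qed

section \<open>Bounded and positive operators on finitely supported vectors\<close>

lemma basis_vec_mem_fin_span: "finite F \<Longrightarrow> g \<in> F \<Longrightarrow> basis_vec g \<in> fin_span F"
  by (auto simp: fin_span_iff basis_vec_def)

lemma fin_span_expansion:
  assumes "finite F" "u \<in> fin_span F"
  shows "u = (\<lambda>h. \<Sum>g\<in>F. u g * basis_vec g h)"
  using assms by (auto simp: fin_span_iff basis_vec_def fun_eq_iff if_distrib[of "\<lambda>t. _ * t"] cong: if_cong)

lemma bounded_op_add:
  assumes "bounded_op G A" "x \<in> L2 G" "y \<in> L2 G"
  shows "A (\<lambda>g. x g + y g) = (\<lambda>g. A x g + A y g)"
  using assms unfolding bounded_op_def by blast

lemma bounded_op_scale:
  assumes "bounded_op G A" "x \<in> L2 G"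
  shows "A (\<lambda>g. c * x g) = (\<lambda>g. c * A x g)"
  using assms unfolding bounded_op_def by blast

lemma bounded_op_fin_span:
  assumes A: "bounded_op G A" and F: "finite F" "F \<subseteq> carrier G" and u: "u \<in> fin_span F"
  shows "A u h = (\<Sum>g\<in>F. u g * A (basis_vec g) h)"
proof -
  have L2: "x \<in> L2 G" if "x \<in> fin_span F" for x
    using fin_span_subset_L2[OF F] that by blast
  \<comment> \<open>The induction is over subsets of \<open>F\<close> with the coefficients of
    \<open>u\<close> fixed, so every partial sum stays in \<open>L2 G\<close>, where linearity of
    \<open>A\<close> is available.\<close>
  have "A (\<lambda>h. \<Sum>g\<in>E. u g * basis_vec g h) = (\<lambda>h. \<Sum>g\<in>E. u g * A (basis_vec g) h)" if "E \<subseteq> F" for E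
    using finite_subset[OF that F(1)] that
  proof (induction E rule: finite_induct)
    case empty
    have "A (\<lambda>h. 0 * (\<lambda>_. 0) h) = (\<lambda>h. 0 * A (\<lambda>_. 0) h)"
      by (rule bounded_op_scale[OF A L2]) (use F in \<open>simp add: fin_span_iff\<close>)
    then show ?case by simp
  next
    case (insert k E)
    have k: "basis_vec k \<in> L2 G"
      using insert F by (intro L2 basis_vec_mem_fin_span) auto
    have "(\<lambda>h. u k * basis_vec k h) \<in> L2 G" "(\<lambda>h. \<Sum>g\<in>E. u g * basis_vec g h) \<in> L2 G"
      using insert.prems F by (intro L2; force intro!: sum.neutral simp: fin_span_iff basis_vec_def)+
    from bounded_op_add[OF A this] show ?case
      using insert by (simp add: bounded_op_scale[OF A k])
  qed
  from this[of F] show ?thesis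
    using fin_span_expansion[OF F(1) u] by simp
qed

text \<open>Since \<open>u\<close> lives on \<open>F\<close>, where \<open>A u\<close> vanishes, (A
  u, u) = 0. For \<open>g\<close> outside \<open>F\<close>, perturbing \<open>u\<close> by multiples
  of \<open>basis_vec g\<close> makes \<open>A u g\<close> a first-order coefficient of a
  nonnegative expression, hence zero.\<close>

lemma positive_op_vanishing:
  assumes A: "bounded_op G A" "positive_op G A"
    and F: "finite F" "F \<subseteq> carrier G" and u: "u \<in> fin_span F"
    and zero: "\<And>g. g \<in> F \<Longrightarrow> A u g = 0"
  shows "A u = (\<lambda>_. 0)"
proof
  fix g
  have uL2: "u \<in> L2 G" using u fin_span_subset_L2[OF F] by blast
  consider "g \<in> F" | "g \<notin> carrier G" | "g \<in> carrier G" "g \<notin> F" by blast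
  then show "A u g = 0"
  proof cases
    case 1
    then show ?thesis by (rule zero)
  next
    case 2
    then show ?thesis using A(1) uL2 by (auto simp: bounded_op_def L2_def)
  next
    case 3
    define w where "w = (basis_vec g :: 'a \<Rightarrow> complex)"
    have K: "finite (insert g F)" "insert g F \<subseteq> carrier G" using 3 F by auto
    have w: "w \<in> fin_span (insert g F)"
      unfolding w_def by (rule basis_vec_mem_fin_span) (use F in auto)
    then have wL2: "w \<in> L2 G" using fin_span_subset_L2[OF K] by blast
    have twL2: "(\<lambda>h. t * w h) \<in> L2 G" for t
    proof -
      have "(\<lambda>h. t * w h) \<in> fin_span (insert g F)" using w K by (auto simp: fin_span_iff)
      then show ?thesis using fin_span_subset_L2[OF K] by blast
    qed
    have ug: "u g = 0" and wg: "w g = 1"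
      using u 3 F by (auto simp: fin_span_iff w_def basis_vec_def)
    have wF: "w h = 0" if "h \<in> F" for h
      using 3 that by (auto simp: w_def basis_vec_def)
    show ?thesis
    proof (rule zero_if_perturbation_nonneg)
      fix t
      define x where "x = (\<lambda>h. u h + t * w h)"
      have x: "x \<in> fin_span (insert g F)"
        using u w K F by (auto simp: x_def fin_span_iff)
      have Ax: "A x = (\<lambda>h. A u h + t * A w h)"
        unfolding x_def using bounded_op_add[OF A(1) uL2 twL2] bounded_op_scale[OF A(1) wL2] by simp
      have xg: "x g = t" and xF: "\<And>h. h \<in> F \<Longrightarrow> x h = u h"
        by (simp_all add: x_def ug wg wF)
      have "l2_inner G (A x) x = (\<Sum>h\<in>insert g F. A x h * cnj (x h))"
        by (rule l2_inner_fin_span[OF K x])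
      \<comment> \<open>On \<open>F\<close> the contribution of \<open>A u\<close> is zero and
        \<open>x\<close> agrees with \<open>u\<close>; at \<open>g\<close> the value of
        \<open>x\<close> is \<open>t\<close>.\<close>
      also have "\<dots> = (A u g + t * A w g) * cnj t + (\<Sum>h\<in>F. t * (A w h * cnj (u h)))"
        using 3 F by (simp add: Ax xg xF zero mult.assoc)
      also have "\<dots> = t * (\<Sum>h\<in>F. A w h * cnj (u h)) + cnj t * A u g + t * cnj t * A w g"
        by (simp add: sum_distrib_left algebra_simps)
      finally show "t * (\<Sum>h\<in>F. A w h * cnj (u h)) + cnj t * A u g + t * cnj t * A w g \<in> \<real>\<^sub>\<ge>\<^sub>0"
        using A(2) x fin_span_subset_L2[OF K] unfolding positive_op_def by (metis subsetD)
    next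
      have "l2_inner G (A w) w = A w g"
        using l2_inner_fin_span[OF K w, of "A w"] 3 F by (simp add: wg wF)
      then show "A w g \<in> \<real>\<^sub>\<ge>\<^sub>0"
        using A(2) wL2 unfolding positive_op_def by metis
    qed
  qed
qed

section \<open>Compressions and their matrices\<close>

lemma compression_apply:
  assumes "finite F" "F \<subseteq> carrier G"
  shows "compression G A F u = (\<lambda>g. if g \<in> F then A u g else 0)"
  using assms by (simp add: compression_def orth_proj_fin_span)

lemma endo_mat_compression_mult_vec:
  assumes A: "bounded_op G A" and F: "finite F" "F \<subseteq> carrier G"
    and e: "bij_betw e {..<n} F" and u: "u \<in> fin_span F"
  shows "endo_mat e n (compression G A F) *\<^sub>v vec n (\<lambda>i. u (e i)) = vec n (\<lambda>i. A u (e i))"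
proof (rule eq_vecI)
  fix i assume "i < dim_vec (vec n (\<lambda>i. A u (e i)))"
  then have i: "i < n" by simp
  have eF: "e j \<in> F" if "j < n" for j
    using e that by (auto simp: bij_betw_def)
  have "(endo_mat e n (compression G A F) *\<^sub>v vec n (\<lambda>i. u (e i))) $ i =
      (\<Sum>j<n. u (e j) * A (basis_vec (e j)) (e i))"
    using i eF by (simp add: endo_mat_def scalar_prod_def compression_apply[OF F] lessThan_atLeast0 mult.commute)
  also have "\<dots> = (\<Sum>g\<in>F. u g * A (basis_vec g) (e i))"
    by (rule sum.reindex_bij_betw[OF e])
  also have "\<dots> = A u (e i)"
    by (rule bounded_op_fin_span[OF A F u, symmetric])
  finally show "(endo_mat e n (compression G A F) *\<^sub>v vec n (\<lambda>i. u (e i))) $ i =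
      vec n (\<lambda>i. A u (e i)) $ i"
    using i by simp
qed (simp add: endo_mat_def)

lemma fin_span_vec_coords:
  assumes "finite F" and e: "bij_betw e {..<n} F" and v: "v \<in> carrier_vec n"
  obtains u where "u \<in> fin_span F" "v = vec n (\<lambda>i. u (e i))"
proof -
  define u where "u = (\<lambda>g. if g \<in> F then v $ inv_into {..<n} e g else 0)"
  have "u (e i) = v $ i" if "i < n" for i
    using e that by (auto simp: u_def bij_betw_def)
  then have "v = vec n (\<lambda>i. u (e i))"
    using v by (intro eq_vecI) auto
  moreover have "u \<in> fin_span F"
    using assms(1) by (simp add: fin_span_iff u_def)
  ultimately show ?thesis using that by blast
qed

text \<open>This makes the \<open>inv_into\<close> in the definition of \<psi> a genuine preimage.
  In finite dimension a trivial kernel suffices: a kernel vector \<open>u\<close> has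
  \<open>A u\<close> zero on \<open>F\<close>, hence everywhere, and injectivity on
  \<open>group_alg G\<close> gives u = 0.\<close>

lemma compression_surj:
  assumes A: "bounded_op G A" "positive_op G A" "inj_on A (group_alg G)"
    and F: "finite F" "F \<subseteq> carrier G"
  shows "fin_span F \<subseteq> compression G A F ` fin_span F"
proof
  fix b :: "'a \<Rightarrow> complex" assume b: "b \<in> fin_span F"
  obtain e where e: "bij_betw e {..<card F} F"
    using ex_bij_betw_nat_finite[OF F(1)] by (auto simp: lessThan_atLeast0)
  let ?n = "card F"
  let ?M = "endo_mat e ?n (compression G A F)"
  have eq_on_F: "x = y" if "x \<in> fin_span F" "y \<in> fin_span F"
      "vec ?n (\<lambda>i. x (e i)) = vec ?n (\<lambda>i. y (e i))" for x y :: "'a \<Rightarrow> complex"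
  proof
    fix g
    show "x g = y g"
    proof (cases "g \<in> F")
      case True
      then obtain i where "i < ?n" "g = e i" using e by (auto simp: bij_betw_def)
      then show ?thesis using arg_cong[OF that(3), of "\<lambda>v. v $ i"] by simp
    qed (use that F in \<open>auto simp: fin_span_iff\<close>)
  qed
  have M: "?M \<in> carrier_mat ?n ?n" by (simp add: endo_mat_def)
  obtain v where v: "v \<in> carrier_vec ?n" "?M *\<^sub>v v = vec ?n (\<lambda>i. b (e i))"
  proof (rule inj_square_mat_solvable[OF M])
    fix v assume v: "v \<in> carrier_vec ?n" "?M *\<^sub>v v = 0\<^sub>v ?n"
    obtain u where u: "u \<in> fin_span F" "v = vec ?n (\<lambda>i. u (e i))"
      using fin_span_vec_coords[OF F(1) e v(1)] .
    have 0: "(\<lambda>_. 0) \<in> fin_span F" using F by (simp add: fin_span_iff)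
    have "A u (e i) = 0" if "i < ?n" for i
      using arg_cong[OF v(2), of "\<lambda>v. v $ i"] that
      by (simp add: u(2) endo_mat_compression_mult_vec[OF A(1) F e u(1)])
    then have "A u g = 0" if "g \<in> F" for g
      using that e by (force simp: bij_betw_def)
    then have "A u = (\<lambda>_. 0)"
      by (rule positive_op_vanishing[OF A(1,2) F u(1)])
    also have "\<dots> = A (\<lambda>_. 0)"
      using bounded_op_fin_span[OF A(1) F 0] by (simp add: fun_eq_iff)
    finally have "u = (\<lambda>_. 0)"
      using inj_onD[OF A(3)] u(1) 0 F unfolding group_alg_def by blast
    then show "v = 0\<^sub>v ?n" by (simp add: u(2) zero_vec_def)
  qed auto
  obtain u where u: "u \<in> fin_span F" "v = vec ?n (\<lambda>i. u (e i))"
    using fin_span_vec_coords[OF F(1) e v(1)] .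
  have eF: "e i \<in> F" if "i < ?n" for i using e that by (auto simp: bij_betw_def)
  have "compression G A F u = b"
  proof (rule eq_on_F[OF _ b])
    show "compression G A F u \<in> fin_span F"
      using F by (simp add: compression_apply fin_span_iff)
    have "vec ?n (\<lambda>i. compression G A F u (e i)) = vec ?n (\<lambda>i. A u (e i))"
      by (rule eq_vecI) (auto simp: compression_apply[OF F] eF)
    then show "vec ?n (\<lambda>i. compression G A F u (e i)) = vec ?n (\<lambda>i. b (e i))"
      using v(2) by (simp add: u(2) endo_mat_compression_mult_vec[OF A(1) F e u(1)])
  qed
  with u(1) show "b \<in> compression G A F ` fin_span F" by blast
qed

text \<open>The vector \<open>x\<close> is A-orthogonal to \<open>fin_span F\<close> and has
  coefficient 1 at \<gamma>, so its coordinates serve as the vector in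
  \<open>det_eq_last_pivot\<close>.\<close>

lemma endo_det_insert:
  assumes A: "bounded_op G A" and F: "finite F" "F \<subseteq> carrier G"
    and \<gamma>: "\<gamma> \<in> carrier G" "\<gamma> \<notin> F"
    and x: "x \<in> fin_span (insert \<gamma> F)" "x \<gamma> = 1" "\<And>g. g \<in> F \<Longrightarrow> A x g = 0"
  shows "endo_det (insert \<gamma> F) (compression G A (insert \<gamma> F)) = A x \<gamma> * endo_det F (compression G A F)"
proof -
  let ?n = "card F" and ?F' = "insert \<gamma> F"
  have F': "finite ?F'" "?F' \<subseteq> carrier G" using F \<gamma> by auto
  obtain e0 where e0: "bij_betw e0 {..<?n} F"
    using ex_bij_betw_nat_finite[OF F(1)] by (auto simp: lessThan_atLeast0)
  \<comment> \<open>Placing \<gamma> last makes the matrix for \<open>F\<close> the leading block of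
    the matrix for \<open>insert \<gamma> F\<close>, with one enumeration serving both.\<close>
  define e where "e = e0(?n := \<gamma>)"
  have e: "bij_betw e {..<?n} F"
    using e0 by (subst bij_betw_cong[of _ _ e0]) (auto simp: e_def)
  have e_n: "e ?n = \<gamma>" by (simp add: e_def)
  have card: "card ?F' = Suc ?n" using F \<gamma> by simp
  have e': "bij_betw e {..<Suc ?n} ?F'"
    using e \<gamma> notIn_Un_bij_betw[of ?n "{..<?n}" e F] by (simp add: e_def lessThan_Suc)
  define M where "M = endo_mat e (Suc ?n) (compression G A ?F')"
  define v where "v = vec (Suc ?n) (\<lambda>i. x (e i))"
  have eF: "e i \<in> F" if "i < ?n" for i using e that by (auto simp: bij_betw_def)
  have Mv: "M *\<^sub>v v = vec (Suc ?n) (\<lambda>i. A x (e i))"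
    unfolding M_def v_def by (rule endo_mat_compression_mult_vec[OF A F' e' x(1)])
  have "det M = (M *\<^sub>v v) $ ?n * det (mat_delete M ?n ?n)"
    by (rule det_eq_last_pivot) (auto simp: Mv eF x, auto simp: M_def endo_mat_def v_def e_def x)
  also have "mat_delete M ?n ?n = endo_mat e ?n (compression G A F)"
    by (rule eq_matI)
      (auto simp: M_def mat_delete_def endo_mat_def compression_apply[OF F] compression_apply[OF F'] eF)
  finally show ?thesis
    using endo_det_eq[OF e] endo_det_eq[of e ?F'] e' e_n by (simp add: card Mv flip: M_def)
qed

theorem corollary10:
  fixes \<Gamma> :: "('g, 'b) monoid_scheme"
    and A :: "('g \<Rightarrow> complex) \<Rightarrow> ('g \<Rightarrow> complex)"
    and F F' :: "'g set"
    and \<gamma> :: 'g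
    and \<psi> \<phi> :: "('g \<Rightarrow> complex) \<Rightarrow> ('g \<Rightarrow> complex)"
    and \<Phi>\<^sub>\<gamma> :: "'g \<Rightarrow> complex"
  assumes "group \<Gamma>" and "countable (carrier \<Gamma>)"
    and "A \<in> group_vN \<Gamma>" and "positive_op \<Gamma> A" and "inj_on A (group_alg \<Gamma>)"
    and "finite F" and "F \<subseteq> carrier \<Gamma>"
    and "\<gamma> \<in> carrier \<Gamma> - F" and "F' = F \<union> {\<gamma>}"
    and "\<And>u. u \<in> fin_span F' \<Longrightarrow>
           \<psi> u = inv_into (fin_span F) (compression \<Gamma> A F) (orth_proj \<Gamma> (fin_span F) (A u))"
    and "\<And>u. u \<in> fin_span F' \<Longrightarrow> \<phi> u = (\<lambda>g. u g - \<psi> u g)"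
    and "\<Phi>\<^sub>\<gamma> = \<phi> (basis_vec \<gamma>)"
  shows "endo_det F' (compression \<Gamma> A F') =
           complex_of_real ((op_norm \<Gamma> A \<Phi>\<^sub>\<gamma>)\<^sup>2) * endo_det F (compression \<Gamma> A F)"
proof -
  note F = assms(6,7)
  have A: "bounded_op \<Gamma> A" using assms(3) by (simp add: group_vN_def)
  have \<gamma>: "\<gamma> \<in> carrier \<Gamma>" "\<gamma> \<notin> F" using assms(8) by auto
  have F'_eq: "F' = insert \<gamma> F" using assms(9) by simp
  have F': "finite F'" "F' \<subseteq> carrier \<Gamma>" using F \<gamma> F'_eq by auto
  have L2: "x \<in> L2 \<Gamma>" if "x \<in> fin_span F'" for x using fin_span_subset_L2[OF F'] that by blast
  define v where "v = \<psi> (basis_vec \<gamma>)"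
  have basis: "basis_vec \<gamma> \<in> fin_span F'"
    by (rule basis_vec_mem_fin_span[OF F'(1)]) (simp add: F'_eq)
  \<comment> \<open>Although \<open>basis_vec \<gamma>\<close> lies outside
    \<open>fin_span F\<close>, its \<open>compression\<close> is by definition the projection of A
    \<gamma> to \<open>fin_span F\<close>, the vector that \<psi> inverts.\<close>
  have "compression \<Gamma> A F (basis_vec \<gamma>) \<in> compression \<Gamma> A F ` fin_span F"
    using F by (intro subsetD[OF compression_surj[OF A assms(4,5) F]]) (simp add: compression_apply fin_span_iff)
  then have v: "v \<in> fin_span F" and Av: "compression \<Gamma> A F v = compression \<Gamma> A F (basis_vec \<gamma>)"
    using assms(10)[OF basis] unfolding v_def compression_def[of _ _ _ "basis_vec \<gamma>", symmetric]
    by (simp_all add: inv_into_into f_inv_into_f)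
  \<comment> \<open>The difference is written with the scalar -1 so that additivity and homogeneity
    of \<open>A\<close> apply directly.\<close>
  have \<Phi>: "\<Phi>\<^sub>\<gamma> = (\<lambda>g. basis_vec \<gamma> g + (- 1) * v g)"
    using assms(11)[OF basis] assms(12) by (simp add: v_def)
  have vF': "v \<in> fin_span F'" and mvF': "(\<lambda>g. (- 1) * v g) \<in> fin_span F'"
    using v F F' by (auto simp: fin_span_iff F'_eq)
  have \<Phi>F': "\<Phi>\<^sub>\<gamma> \<in> fin_span F'"
    using basis vF' F' by (simp add: \<Phi> fin_span_iff)
  have \<Phi>\<gamma>: "\<Phi>\<^sub>\<gamma> \<gamma> = 1"
    using v F \<gamma> by (simp add: \<Phi> basis_vec_def fin_span_iff)
  have "A \<Phi>\<^sub>\<gamma> = (\<lambda>g. A (basis_vec \<gamma>) g + (- 1) * A v g)"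
    unfolding \<Phi> bounded_op_add[OF A L2[OF basis] L2[OF mvF']] bounded_op_scale[OF A L2[OF vF']] ..
  then have zero: "A \<Phi>\<^sub>\<gamma> g = 0" if "g \<in> F" for g
    using that fun_cong[OF Av, of g] by (simp add: compression_apply[OF F])
  have inner: "l2_inner \<Gamma> (A \<Phi>\<^sub>\<gamma>) \<Phi>\<^sub>\<gamma> = A \<Phi>\<^sub>\<gamma> \<gamma>"
    using l2_inner_fin_span[OF F' \<Phi>F', of "A \<Phi>\<^sub>\<gamma>"] F \<gamma> by (simp add: F'_eq \<Phi>\<gamma> zero)
  have "A \<Phi>\<^sub>\<gamma> \<gamma> \<in> \<real>\<^sub>\<ge>\<^sub>0"
    using assms(4) L2[OF \<Phi>F'] inner unfolding positive_op_def by metis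
  \<comment> \<open>Nonnegativity is what lets the square undo \<open>sqrt\<close> and makes
    \<open>Re\<close> lossless.\<close>
  then have "complex_of_real ((op_norm \<Gamma> A \<Phi>\<^sub>\<gamma>)\<^sup>2) = A \<Phi>\<^sub>\<gamma> \<gamma>"
    by (simp add: op_norm_def inner complex_nonneg_Reals_iff complex_eq_iff)
  then show ?thesis
    using endo_det_insert[OF A F \<gamma>, of "\<Phi>\<^sub>\<gamma>"] \<Phi>F' \<Phi>\<gamma> zero by (simp add: F'_eq)
qed

end
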